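(* Consider the physical-layer-security coalition formation game with finite user set $\mathcal{N}=\{1,\dots,N\}$ and payoffs $\phi_i(S)\in\mathbb{R}\cup\{-\infty\}$ ($\emptyset\neq S\subseteq\mathcal{N}$, $i\in S$) defined in the context, together with the Pareto order $\triangleright$ and the merge-and-split coalition formation algorithm. Then every partition of $\mathcal{N}$ resulting from the algorithm (i.e. every partition at which an iteration of merge and split operations, started from a partition of $\mathcal{N}$, terminates) is $\mathbb{D}_{hp}$-stable.
   Context: **Model.** There are $N$ users $\mathcal{N}=\{1,\dots,N\}$, destinations $\mathcal{M}=\{1,\dots,M\}$, and eavesdroppers $\mathcal{K}=\{1,\dots,K\}$ with $K>1$, located at distinct points. Each user $i$ has an assigned destination $m_i\in\mathcal{M}$. Fix the path-loss exponent $\mu>0$, noise variance $\sigma^2>0$, power per slot $\tilde P>0$, and target signal-to-noise ratio $\nu_0>0$. The channel gains are $h_{i,m_i}=d_{i,m_i}^{-\mu/2}e^{\mathrm{j}\phi_{i,m_i}}\in\mathbb{C}$ (user $i$ to its destination) and $g_{i,k}=d_{i,k}^{-\mu/2}e^{\mathrm{j}\phi_{i,k}}\in\mathbb{C}$ (user $i$ to eavesdropper $k$). Here $d$ denotes distance, the real numbers $\phi_{i,m_i},\phi_{i,k}$ are phase offsets, and $\mathrm{j}$ is the imaginary unit. Write $a^+=\max(a,0)$. **Payoffs.** A coalition is a nonempty $S\subseteq\mathcal{N}$. For a singleton, the payoff is the non-cooperative secrecy capacity $$\phi_i(\{i\})=\Bigl(\log_2\bigl(1+\tfrac{\tilde P|h_{i,m_i}|^2}{\sigma^2}\bigr)-\max_{1\le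 k\le K}\log_2\bigl(1+\tfrac{\tilde P|g_{i,k}|^2}{\sigma^2}\bigr)\Bigr)^+.$$ For $|S|\ge2$ and $i\in S$, let $\hat i\in S$ be a member of $S$ farthest from $i$. Let $\bar P_{i,\hat i}=\nu_0\sigma^2 d_{i,\hat i}^{\mu}$ and $P_i^S=(\tilde P-\bar P_{i,\hat i})^+$. With $S=\{i_1,\dots,i_{|S|}\}$, set - $\boldsymbol h_S=[h_{i_1,m_{i_1}},\dots,h_{i_{|S|},m_{i_{|S|}}}]^H$ and $\boldsymbol g_S^k=[g_{i_1,k},\dots,g_{i_{|S|},k}]^H$ (column vectors), - $\boldsymbol G_S=[\boldsymbol h_S,\boldsymbol g_S^1,\dots,\boldsymbol g_S^K]^H$, a $(K+1)\times|S|$ matrix, - $\boldsymbol e=[1,0,\dots,0]^H\in\mathbb{C}^{K+1}$, - $\beta_i^S=\sqrt{P_i^S/(\boldsymbol e^H(\boldsymbol G_S\boldsymbol G_S^H)^{-1}\boldsymbol e)}$ and $\boldsymbol w_S^{opt}=\beta_i^S\boldsymbol G_S^H(\boldsymbol G_S\boldsymbol G_S^H)^{-1}\boldsymbol e$. The gain is $v_i(S)=\frac12\log_2\bigl(1+\frac{(\boldsymbol w_S^{opt})^H\boldsymbol h_S\boldsymbol h_S^H\boldsymbol w_S^{opt}}{\sigma^2}\bigr)$. The cost is $c_i(S)=\max_{1\le k\le K}\frac12\log_2\bigl(1+\frac{\bar P_{i,\hat i}|g_{i,k}|^2}{\sigma^2}\bigr)$. The payoff is $\phi_i(S)=(v_i(S)-c_i(S))^+$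 if $P_i^S>0$, and $\phi_i(S)=-\infty$ otherwise. If $|S|\ge2$ and $\boldsymbol G_S\boldsymbol G_S^H$ is singular (in particular whenever $2\le|S|\le K$), nulling the signal at all eavesdroppers is not available and $\phi_i(S)=-\infty$ for all $i\in S$. **Collections and Pareto order.** A collection is a set of mutually disjoint coalitions. It is a partition of $\mathcal{A}\subseteq\mathcal{N}$ if its union is $\mathcal{A}$. For a collection $\mathcal{R}$ and a player $j$ belonging to $R\in\mathcal{R}$, put $\Phi_j(\mathcal{R})=\phi_j(R)$. For two collections $\mathcal{R},\mathcal{S}$ partitioning the same $\mathcal{A}\subseteq\mathcal{N}$, $\mathcal{R}\triangleright\mathcal{S}$ means $\Phi_j(\mathcal{R})\ge\Phi_j(\mathcal{S})$ for all $j\in\mathcal{A}$, with strict inequality for at least one $j\in\mathcal{A}$. $\not\triangleright$ is its negation. **Algorithm.** - Merge rule: in the current partition, replace coalitions $S_1,\dots,S_l$ by $\bigcup_{j=1}^l S_j$ whenever $\{\bigcup_{j=1}^l S_j\}\triangleright\{S_1,\dots,S_l\}$. - Split rule: replace a coalition $\bigcup_{j=1}^l S_j$ (with $S_1,\dots,S_l$ disjoint and nonempty) by $S_1,\dots,S_l$ whenever $\{S_1,\dots,S_l\}\triangleright\{\bigcup_{j=1}^l S_j\}$. The algorithm starts from a partition of $\mathcal{N}$ (initially all singletons) and applies merge and split operations successively until no merge and no split is applicable. The partition reached is the partition resulting from the algorithm. **$\mathbb{D}_{hp}$-stability.** A partition $\mathcal{T}=\{T_1,\dots,T_l\}$ of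 $\mathcal{N}$ is $\mathbb{D}_{hp}$-stable if: 1. for each $i\in\{1,\dots,l\}$ and each partition $\{R_1,\dots,R_m\}$ of $T_i$, $\{R_1,\dots,R_m\}\not\triangleright\{T_i\}$; 2. for each nonempty $S\subseteq\{1,\dots,l\}$, $\{\bigcup_{i\in S}T_i\}\not\triangleright\{T_i\mid i\in S\}$. *)

theory Defs
  imports
    Complex_Main
    "HOL-Library.Extended_Real"
    "HOL-Library.Disjoint_Sets"
    "Jordan_Normal_Form.Gauss_Jordan_Elimination"
    "Jordan_Normal_Form.Schur_Decomposition"
begin

section \<open>The network\<close>

datatype node = User nat | Dest nat | Eve nat

text \<open>
  The index sets are \<open>{1..n_users}\<close>, \<open>{1..n_dests}\<close> and \<open>{1..n_eves}\<close>. The field \<open>location\<close> places the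
  nodes in a metric space (for instance the Euclidean plane), and \<open>phase a b\<close> is the phase offset
  of the channel from \<open>a\<close> to \<open>b\<close>.
\<close>

record 'p network =
  n_users :: nat
  n_dests :: nat
  n_eves :: nat
  location :: "node \<Rightarrow> 'p"
  dest_of :: "nat \<Rightarrow> nat"
  phase :: "node \<Rightarrow> node \<Rightarrow> real"
  path_loss :: real  \<comment> \<open>\<open>\<mu>\<close>\<close>
  noise_var :: real  \<comment> \<open>\<open>\<sigma>\<^sup>2\<close>\<close>
  slot_power :: real  \<comment> \<open>the power per slot \<open>P~\<close>\<close>
  target_snr :: real  \<comment> \<open>\<open>\<nu>\<^sub>0\<close>\<close>

definition users :: "'p network \<Rightarrow> nat set" where
  "users net = {1..n_users net}"

definition dests :: "'p network \<Rightarrow> nat set" where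
  "dests net = {1..n_dests net}"

definition eves :: "'p network \<Rightarrow> nat set" where
  "eves net = {1..n_eves net}"

definition valid_network :: "'p network \<Rightarrow> bool" where
  "valid_network net \<longleftrightarrow>
     n_eves net > 1 \<and>
     (\<forall>i\<in>users net. dest_of net i \<in> dests net) \<and>
     inj_on (location net) (User ` users net \<union> Dest ` dests net \<union> Eve ` eves net) \<and>
     path_loss net > 0 \<and> noise_var net > 0 \<and> slot_power net > 0 \<and> target_snr net > 0"

definition distance :: "'p::metric_space network \<Rightarrow> node \<Rightarrow> node \<Rightarrow> real" where
  "distance net a b = dist (location net a) (location net b)"

definition gain :: "'p::metric_space network \<Rightarrow> node \<Rightarrow> node \<Rightarrow> complex" where
  "gain net a b =
     complex_of_real (distance net a b powr (- path_loss net / 2)) * exp (\<i> * complex_of_real (phase net a b))"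

definition dest_gain :: "'p::metric_space network \<Rightarrow> nat \<Rightarrow> complex" where
  "dest_gain net i = gain net (User i) (Dest (dest_of net i))"

definition eve_gain :: "'p::metric_space network \<Rightarrow> nat \<Rightarrow> nat \<Rightarrow> complex" where
  "eve_gain net k i = gain net (User i) (Eve k)"

section \<open>Payoffs\<close>

definition pos_part :: "real \<Rightarrow> real" where
  "pos_part a = max a 0"

definition noncoop_capacity :: "'p::metric_space network \<Rightarrow> nat \<Rightarrow> real" where
  "noncoop_capacity net i = pos_part
     (log 2 (1 + slot_power net * (cmod (dest_gain net i))\<^sup>2 / noise_var net)
      - Max ((\<lambda>k. log 2 (1 + slot_power net * (cmod (eve_gain net k i))\<^sup>2 / noise_var net)) ` eves net))"

text \<open>Ties are broken arbitrarily; only the distance from \<open>i\<close> to \<open>farthest net S i\<close> is used.\<close>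

definition farthest :: "'p::metric_space network \<Rightarrow> nat set \<Rightarrow> nat \<Rightarrow> nat" where
  "farthest net S i = arg_max_on (\<lambda>j. distance net (User i) (User j)) S"

definition broadcast_power :: "'p::metric_space network \<Rightarrow> nat set \<Rightarrow> nat \<Rightarrow> real" where
  "broadcast_power net S i =
     target_snr net * noise_var net * distance net (User i) (User (farthest net S i)) powr path_loss net"

definition remaining_power :: "'p::metric_space network \<Rightarrow> nat set \<Rightarrow> nat \<Rightarrow> real" where
  "remaining_power net S i = pos_part (slot_power net - broadcast_power net S i)"

text \<open>
  The members of a coalition are enumerated in increasing order. As the column vectors are written
  \<open>[\<dots>]\<^sup>H\<close>, their entries are the complex conjugates of the gains.
\<close>

definition h_vec :: "'p::metric_space network \<Rightarrow> nat set \<Rightarrow> complex vec" where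
  "h_vec net S = conjugate (vec_of_list (map (dest_gain net) (sorted_list_of_set S)))"

definition g_vec :: "'p::metric_space network \<Rightarrow> nat set \<Rightarrow> nat \<Rightarrow> complex vec" where
  "g_vec net S k = conjugate (vec_of_list (map (eve_gain net k) (sorted_list_of_set S)))"

definition G_mat :: "'p::metric_space network \<Rightarrow> nat set \<Rightarrow> complex mat" where
  "G_mat net S =
     mat_adjoint (mat_of_cols (card S) (h_vec net S # map (g_vec net S) [1..<n_eves net + 1]))"

definition gram :: "'p::metric_space network \<Rightarrow> nat set \<Rightarrow> complex mat" where
  "gram net S = G_mat net S * mat_adjoint (G_mat net S)"

definition gram_inv :: "'p::metric_space network \<Rightarrow> nat set \<Rightarrow> complex mat" where
  "gram_inv net S = the (mat_inverse (gram net S))"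

definition e_vec :: "'p network \<Rightarrow> complex vec" where
  "e_vec net = unit_vec (n_eves net + 1) 0"

text \<open>
  Note that \<open>x \<bullet>c y\<close> is \<open>y\<^sup>H x\<close>. The Hermitian forms below are real-valued, so taking real parts
  is only a change of type.
\<close>

definition beta :: "'p::metric_space network \<Rightarrow> nat set \<Rightarrow> nat \<Rightarrow> real" where
  "beta net S i =
     sqrt (remaining_power net S i / Re ((gram_inv net S *\<^sub>v e_vec net) \<bullet>c e_vec net))"

definition w_opt :: "'p::metric_space network \<Rightarrow> nat set \<Rightarrow> nat \<Rightarrow> complex vec" where
  "w_opt net S i =
     complex_of_real (beta net S i) \<cdot>\<^sub>v
       (mat_adjoint (G_mat net S) *\<^sub>v (gram_inv net S *\<^sub>v e_vec net))"

definition coalition_gain :: "'p::metric_space network \<Rightarrow> nat set \<Rightarrow> nat \<Rightarrow> real" where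
  "coalition_gain net S i =
     1/2 * log 2 (1 + Re ((h_vec net S \<bullet>c w_opt net S i) * (w_opt net S i \<bullet>c h_vec net S)) / noise_var net)"

definition coalition_cost :: "'p::metric_space network \<Rightarrow> nat set \<Rightarrow> nat \<Rightarrow> real" where
  "coalition_cost net S i =
     Max ((\<lambda>k. 1/2 * log 2 (1 + broadcast_power net S i * (cmod (eve_gain net k i))\<^sup>2 / noise_var net)) ` eves net)"

definition payoff :: "'p::metric_space network \<Rightarrow> nat \<Rightarrow> nat set \<Rightarrow> ereal" where
  "payoff net i S =
     (if S = {i} then ereal (noncoop_capacity net i)
      else if det (gram net S) = 0 then - \<infinity>
      else if remaining_power net S i > 0
        then ereal (pos_part (coalition_gain net S i - coalition_cost net S i))
      else - \<infinity>)"

section \<open>Collections and the Pareto order\<close>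

definition collection_payoff :: "'p::metric_space network \<Rightarrow> nat set set \<Rightarrow> nat \<Rightarrow> ereal" where
  "collection_payoff net \<R> j = payoff net j (THE R. R \<in> \<R> \<and> j \<in> R)"

definition pareto_preferred :: "'p::metric_space network \<Rightarrow> nat set set \<Rightarrow> nat set set \<Rightarrow> bool" where
  "pareto_preferred net \<R> \<S> \<longleftrightarrow>
     (\<exists>A \<subseteq> users net. partition_on A \<R> \<and> partition_on A \<S> \<and>
        (\<forall>j\<in>A. collection_payoff net \<R> j \<ge> collection_payoff net \<S> j) \<and>
        (\<exists>j\<in>A. collection_payoff net \<R> j > collection_payoff net \<S> j))"

section \<open>The merge-and-split algorithm\<close>

definition merge_step :: "'p::metric_space network \<Rightarrow> nat set set \<Rightarrow> nat set set \<Rightarrow> bool" where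
  "merge_step net \<P> \<Q> \<longleftrightarrow>
     (\<exists>\<S>. \<S> \<subseteq> \<P> \<and> \<S> \<noteq> {} \<and> pareto_preferred net {\<Union>\<S>} \<S> \<and> \<Q> = (\<P> - \<S>) \<union> {\<Union>\<S>})"

definition split_step :: "'p::metric_space network \<Rightarrow> nat set set \<Rightarrow> nat set set \<Rightarrow> bool" where
  "split_step net \<P> \<Q> \<longleftrightarrow>
     (\<exists>C\<in>\<P>. \<exists>\<S>. partition_on C \<S> \<and> pareto_preferred net \<S> {C} \<and> \<Q> = (\<P> - {C}) \<union> \<S>)"

definition merge_split_step :: "'p::metric_space network \<Rightarrow> nat set set \<Rightarrow> nat set set \<Rightarrow> bool" where
  "merge_split_step net \<P> \<Q> \<longleftrightarrow> merge_step net \<P> \<Q> \<or> split_step net \<P> \<Q>"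

text \<open>
  The order in which merges and splits are carried out is left open, so every schedule of the two
  operations is covered.
\<close>

definition algorithm_result ::
    "'p::metric_space network \<Rightarrow> nat set set \<Rightarrow> nat set set \<Rightarrow> bool" where
  "algorithm_result net \<P> \<T> \<longleftrightarrow>
     (merge_split_step net)\<^sup>*\<^sup>* \<P> \<T> \<and> (\<nexists>\<Q>. merge_step net \<T> \<Q>) \<and> (\<nexists>\<Q>. split_step net \<T> \<Q>)"

section \<open>Stability\<close>

definition Dhp_stable :: "'p::metric_space network \<Rightarrow> nat set set \<Rightarrow> bool" where
  "Dhp_stable net \<T> \<longleftrightarrow>
     partition_on (users net) \<T> \<and>
     (\<forall>T\<in>\<T>. \<forall>\<R>. partition_on T \<R> \<longrightarrow> \<not> pareto_preferred net \<R> {T}) \<and>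
     (\<forall>\<S>. \<S> \<subseteq> \<T> \<and> \<S> \<noteq> {} \<longrightarrow> \<not> pareto_preferred net {\<Union>\<S>} \<S>)"

end

(*
  Stability is exactly the termination condition of the algorithm, once the result is known
  to be a partition; this holds because merges and splits both replace part of a partition by
  another partition of the same set of users.
*)
theory Submission
  imports Defs
begin

text \<open>Serves merges and splits alike. The blocks of \<open>\<R>\<close> stay inside
  \<open>\<Union>\<S>\<close>, which misses every block of \<open>\<P> - \<S>\<close> because
  distinct blocks of \<open>\<P>\<close> are disjoint.\<close>

lemma partition_on_replace:
  assumes "partition_on A \<P>" "\<S> \<subseteq> \<P>" "partition_on (\<Union>\<S>) \<R>"
  shows "partition_on A ((\<P> - \<S>) \<union> \<R>)"
proof -
  have "disjoint (\<P> - \<S>)"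
    using assms(1) by (auto simp: partition_on_def disjoint_def)
  moreover have "\<Union>(\<P> - \<S>) \<inter> \<Union>\<R> = {}"
    using assms by (force simp: partition_on_def disjoint_def)
  ultimately have "disjoint ((\<P> - \<S>) \<union> \<R>)"
    using assms(3) by (intro disjoint_union) (auto simp: partition_on_def)
  moreover have "\<Union>((\<P> - \<S>) \<union> \<R>) = A"
    using assms by (auto simp: partition_on_def)
  ultimately show ?thesis
    using assms(1,3) by (auto simp: partition_on_def)
qed

lemma merge_step_partition_on:
  assumes "merge_step net \<P> \<Q>" "partition_on A \<P>"
  shows "partition_on A \<Q>"
proof -
  obtain \<S> where \<S>: "\<S> \<subseteq> \<P>" "pareto_preferred net {\<Union>\<S>} \<S>" "\<Q> = (\<P> - \<S>) \<union> {\<Union>\<S>}"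
    using assms(1) by (auto simp: merge_step_def)
  \<comment> \<open>A one-block partition needs a nonempty block; this is part of the Pareto
    preference, which only compares partitions.\<close>
  then have "partition_on (\<Union>\<S>) {\<Union>\<S>}"
    by (auto simp: pareto_preferred_def partition_on_def)
  with \<S> assms(2) show ?thesis
    by (simp only: partition_on_replace)
qed

lemma split_step_partition_on:
  assumes "split_step net \<P> \<Q>" "partition_on A \<P>"
  shows "partition_on A \<Q>"
proof -
  obtain C \<S> where "C \<in> \<P>" "partition_on C \<S>" "\<Q> = (\<P> - {C}) \<union> \<S>"
    using assms(1) by (auto simp: split_step_def)
  then show ?thesis
    \<comment> \<open>A split replaces the one-block subfamily \<open>{C}\<close>, whose union is
      \<open>C\<close>.\<close>
    using partition_on_replace[OF assms(2), of "{C}" \<S>] by simp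
qed

lemma merge_split_steps_partition_on:
  assumes "(merge_split_step net)\<^sup>*\<^sup>* \<P> \<Q>" "partition_on A \<P>"
  shows "partition_on A \<Q>"
  using assms
  by (induction rule: rtranclp_induct)
    (auto simp: merge_split_step_def intro: merge_step_partition_on split_step_partition_on)

theorem theorem1:
  fixes net :: "'p::metric_space network"
    and \<P> \<T> :: "nat set set"
  assumes "valid_network net"
    and "partition_on (users net) \<P>"
    and "algorithm_result net \<P> \<T>"
  shows "Dhp_stable net \<T>"
proof -
  have "partition_on (users net) \<T>"
    using assms(2,3) by (auto simp: algorithm_result_def intro: merge_split_steps_partition_on)
  \<comment> \<open>A preferred \<open>\<R>\<close> would allow a split to
    \<open>(\<T> - {T}) \<union> \<R>\<close>, against termination. Condition 2 follows in the same
    way from the absence of merges.\<close>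
  moreover have "\<not> pareto_preferred net \<R> {T}" if "T \<in> \<T>" "partition_on T \<R>" for T \<R>
    using assms(3) that unfolding algorithm_result_def split_step_def by blast
  moreover have "\<not> pareto_preferred net {\<Union>\<S>} \<S>" if "\<S> \<subseteq> \<T>" "\<S> \<noteq> {}" for \<S>
    using assms(3) that unfolding algorithm_result_def merge_step_def by blast
  ultimately show ?thesis
    by (simp add: Dhp_stable_def)
qed

end
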